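(* Let $0<q\le p$ satisfy $p^2+q^2<1$, and suppose there exists $\tilde\delta\in(0,1)$ such that $\mathcal S_{p,q}(\delta)<0$ for all $0<\delta<\tilde\delta$. Let $\lambda\in(0,2)$ be the exponent such that $p^\lambda+q^\lambda=1$. Let $g_0$ be a function on $\mathbb R$ with $g_0\ge 0$, $\int_{\mathbb R} g_0(v)\,dv=1$, $\int_{\mathbb R} v\,g_0(v)\,dv=0$, $\int_{\mathbb R} v^2 g_0(v)\,dv=1$, and $$\int_{\mathbb R}|v|^{2+\tilde\delta}g_0(v)\,dv<+\infty .$$ Let $g(t)=g(\cdot,t)$ be the weak solution of the scaled equation $$\partial_t\hat g(\xi,t)+\tfrac12(p^2+q^2-1)\,\xi\,\partial_\xi\hat g(\xi,t)=\hat g(p\xi,t)\,\hat g(q\xi,t)-\hat g(\xi,t)$$ corresponding to the initial density $g_0$. If in addition $$|\hat g_0(\xi)|\le e^{-\beta|\xi|^\nu},\qquad|\xi|>R,$$ for some $R>0$, $\nu>0$ and $\beta>0$, then there exist $\rho>0$ and $\kappa>0$ such that for all $t\ge0$ $$|\hat g(\xi,t)|\le e^{-\kappa\xi^2}\quad\text{for }|\xi|\le\rho,\qquad|\hat g(\xi,t)|\le e^{-\kappa|\xi|^{\min(\nu,\lambda)}}\quad\text{for }|\xi|>\rho .$$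
   Context: For $p,q>0$ and $\delta\ge0$, $\mathcal S_{p,q}(\delta)=p^{2+\delta}+q^{2+\delta}-1-\frac{2+\delta}{2}\,(p^2+q^2-1)$. The Fourier transform is $\hat h(\xi)=\int_{\mathbb R}h(v)e^{-i\xi v}\,dv$ (in the variable $v$ only). Weak solution of the scaled equation with initial density $g_0$: let $f\in C^1([0,+\infty),L^1(\mathbb R))$ be the unique nonnegative solution (known to exist, with unit mass and zero mean for all times) of $\partial_t\hat f(\xi,t)=\hat f(p\xi,t)\hat f(q\xi,t)-\hat f(\xi,t)$, $\hat f(\xi,0)=\hat g_0(\xi)$. Its second moment is $E(t)=\int_{\mathbb R} v^2f(v,t)\,dv=e^{(p^2+q^2-1)t}$. Then $g(v,t)=\sqrt{E(t)}\,f(v\sqrt{E(t)},t)$, equivalently $\hat g(\xi,t)=\hat f(\xi/\sqrt{E(t)},t)$; $g$ solves the scaled equation with $g(\cdot,0)=g_0$ and $\int_{\mathbb R} v^2g(v,t)\,dv=1$ for all $t\ge0$. *)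

theory Defs
  imports "HOL-Analysis.Analysis"
begin

definition S_fun :: "real \<Rightarrow> real \<Rightarrow> real \<Rightarrow> real" where
  "S_fun p q \<delta> =
     p powr (2 + \<delta>) + q powr (2 + \<delta>) - 1 - (2 + \<delta>) / 2 * (p\<^sup>2 + q\<^sup>2 - 1)"

definition fourier :: "(real \<Rightarrow> real) \<Rightarrow> real \<Rightarrow> complex" where
  "fourier h \<xi> = (LINT v|lebesgue. complex_of_real (h v) * exp (- (\<i> * of_real \<xi> * of_real v)))"

definition L1_norm :: "(real \<Rightarrow> real) \<Rightarrow> real" where
  "L1_norm h = (LINT v|lebesgue. \<bar>h v\<bar>)"

text \<open>Functions of time and velocity are written \<open>f t v\<close>; only times \<open>t \<ge> 0\<close> matter.
  Being of class \<open>C\<^sup>1\<close> on \<open>[0, \<infinity>)\<close> with values in \<open>L\<^sup>1(\<real>)\<close> is spelled out on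
  representatives: \<open>f' t\<close> is the (at \<open>t = 0\<close> one-sided) derivative in \<open>L\<^sup>1\<close>-norm.\<close>

definition C1_L1 :: "(real \<Rightarrow> real \<Rightarrow> real) \<Rightarrow> bool" where
  "C1_L1 f \<longleftrightarrow>
     (\<exists>f'. \<forall>t\<ge>0.
        integrable lebesgue (f t) \<and> integrable lebesgue (f' t) \<and>
        ((\<lambda>s. L1_norm (\<lambda>v. (f s v - f t v) / (s - t) - f' t v)) \<longlongrightarrow> 0) (at t within {0..}) \<and>
        ((\<lambda>s. L1_norm (\<lambda>v. f' s v - f' t v)) \<longlongrightarrow> 0) (at t within {0..}))"

text \<open>The values \<open>f t\<close> are elements of \<open>L\<^sup>1\<close>, so nonnegativity is required almost everywhere.
  Unit mass, zero mean and the value of the second moment are consequences of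
  this definition for the initial data considered, hence not part of it.\<close>

definition weak_solution ::
    "real \<Rightarrow> real \<Rightarrow> (real \<Rightarrow> real) \<Rightarrow> (real \<Rightarrow> real \<Rightarrow> real) \<Rightarrow> bool" where
  "weak_solution p q g0 f \<longleftrightarrow>
     C1_L1 f \<and>
     (\<forall>t\<ge>0. AE v in lebesgue. f t v \<ge> 0) \<and>
     (\<forall>\<xi>. \<forall>t\<ge>0. ((\<lambda>s. fourier (f s) \<xi>) has_vector_derivative
        (fourier (f t) (p * \<xi>) * fourier (f t) (q * \<xi>) - fourier (f t) \<xi>)) (at t within {0..})) \<and>
     (\<forall>\<xi>. fourier (f 0) \<xi> = fourier g0 \<xi>)"

definition second_moment :: "(real \<Rightarrow> real) \<Rightarrow> real" where
  "second_moment h = (LINT v|lebesgue. v\<^sup>2 * h v)"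

text \<open>Write \<open>G\<close> for the Fourier transform of \<open>g\<close> in the velocity. The weak solution of the scaled
  equation \<open>\<partial>G/\<partial>t + (p\<^sup>2 + q\<^sup>2 - 1)/2 * \<xi> * \<partial>G/\<partial>\<xi> = G(p\<xi>,t) * G(q\<xi>,t) - G(\<xi>,t)\<close> is by definition the
  weak solution \<open>f\<close> of the unscaled equation, rescaled at each time to unit second moment.\<close>

definition scaled_weak_solution ::
    "real \<Rightarrow> real \<Rightarrow> (real \<Rightarrow> real) \<Rightarrow> (real \<Rightarrow> real \<Rightarrow> real) \<Rightarrow> bool" where
  "scaled_weak_solution p q g0 g \<longleftrightarrow>
     (\<exists>f. weak_solution p q g0 f \<and>
        (\<forall>t\<ge>0. \<forall>v. g t v =
           sqrt (second_moment (f t)) * f t (v * sqrt (second_moment (f t)))))"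

end

theory Submission
  imports Defs "HOL-Probability.Characteristic_Functions"
begin

text \<open>Write \<open>F(\<xi>,t)\<close> for the Fourier transform of the unscaled solution and \<open>s(t) = exp (-c t / 2)\<close> with
\<open>c = 1 - p\<^sup>2 - q\<^sup>2 > 0\<close>. Once the second moment of the solution is known to be \<open>s(t)\<^sup>2\<close>, the transform of
\<open>g(t)\<close> at \<open>\<xi>\<close> is \<open>F(\<xi> / s(t), t)\<close>, so the claim is a bound for \<open>F\<close> in terms of \<open>x = s(t) |\<xi>|\<close>, uniform
in time. Everything is done with \<open>F\<close> and its equation \<open>\<partial>\<^sub>t F = F(p\<xi>) F(q\<xi>) - F\<close>.

Near the origin, the error \<open>w = F - 1 + x\<^sup>2 / 2\<close> of the second order Taylor polynomial satisfies
\<open>\<partial>\<^sub>t w + w = w(p\<xi>) + w(q\<xi>) + (1 - F(p\<xi>)) (1 - F(q\<xi>))\<close>, because the quadratic term is an exact solution of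
the linearised equation. As \<open>|1 - F| \<le> min 2 (x\<^sup>2 / 2)\<close>, the last product is at most \<open>x powr (2 + \<delta>)\<close>. The
function \<open>C x powr (2 + \<delta>)\<close> decays in time at the rate \<open>c (2 + \<delta>) / 2\<close>, while the linear equation damps
\<open>|\<xi>| powr (2 + \<delta>)\<close> at the rate \<open>1 - p powr (2 + \<delta>) - q powr (2 + \<delta>)\<close>. The condition
\<open>S_fun p q \<delta> < 0\<close> says that the damping is the faster of the two, so this function is a
supersolution once \<open>C\<close> is large (\<open>F_remainder_bound\<close>). Hence \<open>|F| \<le> |1 - x\<^sup>2 / 2| + C x powr (2 + \<delta>)\<close>,
which gives the Gaussian bound for \<open>x \<le> \<rho>\<close>, and, by Fatou's lemma and dominated convergence, the value
\<open>s(t)\<^sup>2\<close> of the second moment. No moment of order above two has to be followed in time.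

Away from the origin let \<open>m = min \<nu> lam\<close>. Since \<open>p powr m + q powr m \<ge> 1\<close>, the function
\<open>exp (-\<kappa> x powr m)\<close> is not increased by the product at \<open>p\<xi>\<close> and \<open>q\<xi>\<close>; when \<open>q\<xi>\<close> falls into the Gaussian
region, smallness of \<open>\<kappa>\<close> does the same. It also increases in time, as \<open>s\<close> decreases. The bound therefore
passes from the frequencies \<open>p\<xi>\<close>, \<open>q\<xi>\<close> to \<open>\<xi>\<close>, and an induction on the size of \<open>\<xi>\<close> proves it everywhere
(\<open>F_tail_propagates\<close>). The initial datum satisfies it for all \<open>|\<xi>| > \<rho>\<close>, not only for
\<open>|\<xi>| > R\<close>, because \<open>1 - |h(2\<xi>)| \<le> 4 (1 - |h(\<xi>)|)\<close> for the transform \<open>h\<close> of a probability density.\<close>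

section \<open>Comparison principles\<close>

text \<open>Multiplying by the integrating factor \<open>exp t\<close> turns both sides into derivatives, \<open>exp t * h\<close> and
\<open>(exp t * B)'\<close>, which the mean value inequality compares.\<close>

lemma relaxation_bound:
  fixes w h :: "real \<Rightarrow> complex" and B B' :: "real \<Rightarrow> real"
  assumes "0 \<le> T"
    and w: "\<And>t. 0 \<le> t \<Longrightarrow> t \<le> T \<Longrightarrow> (w has_vector_derivative (h t - w t)) (at t within {0..})"
    and B: "\<And>t. (B has_real_derivative B' t) (at t)"
    and h: "\<And>t. 0 \<le> t \<Longrightarrow> t \<le> T \<Longrightarrow> cmod (h t) \<le> B t + B' t"
    and init: "cmod (w 0) \<le> B 0"
  shows "cmod (w T) \<le> B T"
proof (cases "T = 0")
  case False
  with \<open>0 \<le> T\<close> have "0 < T" by simp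
  let ?w = "\<lambda>t. exp t *\<^sub>R w t" and ?B = "\<lambda>t. exp t * B t"
  have dw: "(?w has_vector_derivative exp t *\<^sub>R h t) (at t within {0..})" if "0 \<le> t" "t \<le> T" for t
    by (rule has_vector_derivative_eq_rhs[OF has_vector_derivative_scaleR[OF _ w[OF that]]])
       (auto intro!: derivative_eq_intros simp: algebra_simps)
  have dB: "(?B has_vector_derivative exp t * (B t + B' t)) (at t)" for t
    unfolding has_real_derivative_iff_has_vector_derivative[symmetric]
    by (auto intro!: derivative_eq_intros B simp: algebra_simps)
  have "norm (?w T - ?w 0) \<le> ?B T - ?B 0"
  proof (rule differentiable_bound_general[OF \<open>0 < T\<close>])
    show "continuous_on {0..T} ?w"
      unfolding continuous_on_eq_continuous_within
      by (auto intro!: continuous_within_subset[OF has_vector_derivative_continuous[OF dw]])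
    show "continuous_on {0..T} ?B"
      using dB by (meson continuous_at_imp_continuous_on has_vector_derivative_continuous)
    fix t assume t: "0 < t" "t < T"
    have "at t within {0..} = at t"
      using t by (intro at_within_interior) (auto simp: interior_real_atLeast)
    then show "(?w has_vector_derivative exp t *\<^sub>R h t) (at t)"
      using dw[of t] t by simp
    show "(?B has_vector_derivative exp t * (B t + B' t)) (at t)" by (rule dB)
    show "norm (exp t *\<^sub>R h t) \<le> exp t * (B t + B' t)"
      using h[of t] t by simp
  qed
  then have "norm (?w T) \<le> ?B T"
    using norm_triangle_ineq2[of "?w T" "?w 0"] init
    by (simp only: exp_zero scaleR_one mult_1)
  then show ?thesis by simp
qed (use init in simp)

text \<open>The equation at \<open>\<xi>\<close> involves \<open>w\<close> only at \<open>p \<xi>\<close> and \<open>q \<xi>\<close>, so a supersolution \<open>W\<close> should dominate \<open>w\<close>; the difficulty is that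
the comparison cannot be started at \<open>\<xi> = 0\<close>. A crude bound \<open>V\<close>, constant in time and not increased by the
two contractions, replaces the start: one use of the equation doubles it, but integration against
\<open>exp (3 t)\<close> divides by four, so the excess \<open>V * exp (3 t)\<close> is halved each time.\<close>

lemma linear_comparison:
  fixes w h :: "real \<Rightarrow> real \<Rightarrow> complex" and W W' :: "real \<Rightarrow> real \<Rightarrow> real"
  assumes w: "\<And>\<xi> t. 0 \<le> t \<Longrightarrow> (w \<xi> has_vector_derivative (h \<xi> t - w \<xi> t)) (at t within {0..})"
    and W: "\<And>\<xi> t. (W \<xi> has_real_derivative W' \<xi> t) (at t)"
    and h: "\<And>\<xi> t. 0 \<le> t \<Longrightarrow> cmod (h \<xi> t) \<le> cmod (w (p * \<xi>) t) + cmod (w (q * \<xi>) t) + \<sigma> \<xi> t"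
    and super: "\<And>\<xi> t. 0 \<le> t \<Longrightarrow> W (p * \<xi>) t + W (q * \<xi>) t + \<sigma> \<xi> t \<le> W \<xi> t + W' \<xi> t"
    and init: "\<And>\<xi>. cmod (w \<xi> 0) \<le> W \<xi> 0"
    and W_nonneg: "\<And>\<xi> t. 0 \<le> t \<Longrightarrow> 0 \<le> W \<xi> t"
    and V: "\<And>\<xi> t. 0 \<le> t \<Longrightarrow> cmod (w \<xi> t) \<le> V \<xi>" "\<And>\<xi>. V (p * \<xi>) \<le> V \<xi>" "\<And>\<xi>. V (q * \<xi>) \<le> V \<xi>"
    and "0 \<le> t"
  shows "cmod (w \<xi> t) \<le> W \<xi> t"
proof -
  have V_nonneg: "0 \<le> V \<xi>" for \<xi>
    using V(1)[of 0 \<xi>] norm_ge_zero order_trans by blast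
  have step: "cmod (w \<xi> t) \<le> W \<xi> t + V \<xi> * exp (3 * t) * (1/2) ^ n" if "0 \<le> t" for n \<xi> t
    using that
  proof (induction n arbitrary: \<xi> t)
    case 0
    have "V \<xi> * 1 \<le> V \<xi> * exp (3 * t)"
      using 0 V_nonneg by (intro mult_left_mono) auto
    then show ?case using V(1)[OF 0, of \<xi>] W_nonneg[OF 0, of \<xi>] by simp
  next
    case (Suc n)
    show ?case
    proof (rule relaxation_bound[where h = "h \<xi>"
          and B = "\<lambda>t. W \<xi> t + V \<xi> * exp (3 * t) * (1/2) ^ Suc n"
          and B' = "\<lambda>t. W' \<xi> t + V \<xi> * (3 * exp (3 * t)) * (1/2) ^ Suc n"])
      show "((\<lambda>t. W \<xi> t + V \<xi> * exp (3 * t) * (1/2) ^ Suc n) has_real_derivative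
              W' \<xi> s + V \<xi> * (3 * exp (3 * s)) * (1/2) ^ Suc n) (at s)" for s
        by (auto intro!: derivative_eq_intros W)
      fix s :: real assume s: "0 \<le> s" "s \<le> t"
      have V': "V (r * \<xi>) * exp (3 * s) * (1/2) ^ n \<le> V \<xi> * exp (3 * s) * (1/2) ^ n"
        if "V (r * \<xi>) \<le> V \<xi>" for r
        by (intro mult_right_mono that) auto
      \<comment> \<open>the two terms at \<open>p * \<xi>\<close> and \<open>q * \<xi>\<close> give the factor 2; the excess and its derivative add up to 4 times the excess, now with \<open>(1/2) ^ Suc n\<close>\<close>
      have "cmod (h \<xi> s) \<le> W \<xi> s + W' \<xi> s + 2 * (V \<xi> * exp (3 * s) * (1/2) ^ n)"
        using h[OF s(1), of \<xi>] super[OF s(1), of \<xi>] Suc.IH[OF s(1), of "p * \<xi>"]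
          Suc.IH[OF s(1), of "q * \<xi>"] V'[OF V(2)] V'[OF V(3)] by linarith
      then show "cmod (h \<xi> s) \<le> W \<xi> s + V \<xi> * exp (3 * s) * (1/2) ^ Suc n +
          (W' \<xi> s + V \<xi> * (3 * exp (3 * s)) * (1/2) ^ Suc n)"
        by simp
    next
      show "cmod (w \<xi> 0) \<le> W \<xi> 0 + V \<xi> * exp (3 * 0) * (1/2) ^ Suc n"
        using init[of \<xi>] V_nonneg[of \<xi>] by (simp add: add_increasing2)
    qed (use Suc.prems w in auto)
  qed
  have "(\<lambda>n. W \<xi> t + V \<xi> * exp (3 * t) * (1/2) ^ n) \<longlonglongrightarrow> W \<xi> t + V \<xi> * exp (3 * t) * 0"
    by (intro tendsto_intros LIMSEQ_power_zero) auto
  then show ?thesis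
    using step[OF \<open>0 \<le> t\<close>, of \<xi>] by (intro LIMSEQ_le_const[of _ "W \<xi> t"]) auto
qed

text \<open>The equation for the total mass, at its equilibrium \<open>1\<close>. With \<open>M\<close> a bound for \<open>m\<close> on
\<open>[0, T]\<close>, the function \<open>(m - 1)\<^sup>2 exp (-2 M t)\<close> cannot increase.\<close>

lemma logistic_stays_at_one:
  fixes m :: "real \<Rightarrow> real"
  assumes m: "\<And>t. 0 \<le> t \<Longrightarrow> (m has_real_derivative (m t * m t - m t)) (at t within {0..})"
    and "m 0 = 1" and "0 \<le> T"
  shows "m T = 1"
proof -
  have cont: "continuous_on {0..T} m"
    unfolding continuous_on_eq_continuous_within
    by (auto intro!: continuous_within_subset[OF DERIV_continuous[OF m]])
  then have "bounded (m ` {0..T})"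
    by (intro compact_imp_bounded compact_continuous_image) auto
  then obtain M where M: "\<And>t. 0 \<le> t \<Longrightarrow> t \<le> T \<Longrightarrow> \<bar>m t\<bar> \<le> M"
    unfolding bounded_iff by force
  let ?z = "\<lambda>t. (m t - 1)\<^sup>2 * exp (- (2 * M * t))"
  have "?z T \<le> ?z 0"
  proof (rule DERIV_nonpos_imp_decreasing_open[OF \<open>0 \<le> T\<close>])
    show "continuous_on {0..T} ?z"
      by (intro continuous_intros cont)
    fix t assume t: "0 < t" "t < T"
    have "at t within {0..} = at t"
      using t by (intro at_within_interior) (auto simp: interior_real_atLeast)
    then have "(m has_real_derivative (m t * m t - m t)) (at t)"
      using m[of t] t by simp
    then have "(?z has_real_derivative 2 * (m t - M) * ((m t - 1)\<^sup>2 * exp (- (2 * M * t)))) (at t)"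
      by (auto intro!: derivative_eq_intros simp: algebra_simps power2_eq_square)
    moreover have "2 * (m t - M) * ((m t - 1)\<^sup>2 * exp (- (2 * M * t))) \<le> 0"
      using M[of t] t by (intro mult_nonpos_nonneg[of "2 * (m t - M)"]) (auto simp: abs_le_iff)
    ultimately show "\<exists>y. (?z has_real_derivative y) (at t) \<and> y \<le> 0" by blast
  qed
  then have "(m T - 1)\<^sup>2 * exp (- (2 * M * T)) \<le> 0"
    using \<open>m 0 = 1\<close> by simp
  then have "(m T - 1)\<^sup>2 \<le> 0" 
    by (simp add: mult_le_0_iff)
  then show ?thesis by simp
qed

section \<open>Fourier transforms of densities\<close>

lemma integrable_fourier:
  fixes h :: "real \<Rightarrow> real"
  assumes "integrable lebesgue h"
  shows "integrable lebesgue (\<lambda>v. complex_of_real (h v) * exp (- (\<i> * of_real \<xi> * of_real v)))"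
proof (rule Bochner_Integration.integrable_bound[OF assms])
  have "(\<lambda>v::real. exp (- (\<i> * of_real \<xi> * of_real v))) \<in> borel_measurable borel"
    by (intro borel_measurable_continuous_onI continuous_intros)
  then have "(\<lambda>v::real. exp (- (\<i> * of_real \<xi> * of_real v))) \<in> borel_measurable lebesgue"
    by (simp add: measurable_completion)
  with assms show "(\<lambda>v. complex_of_real (h v) * exp (- (\<i> * of_real \<xi> * of_real v))) \<in> borel_measurable lebesgue"
    by (intro borel_measurable_times) auto
qed (auto simp: norm_mult)

lemma fourier_at_zero: "fourier h 0 = of_real (LINT v|lebesgue. h v)"
  by (simp add: fourier_def)

lemma cmod_fourier_le:
  assumes "integrable lebesgue h" "AE v in lebesgue. 0 \<le> h v"
  shows "cmod (fourier h \<xi>) \<le> (LINT v|lebesgue. h v)"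
proof -
  have "cmod (fourier h \<xi>) \<le> (LINT v|lebesgue. cmod (complex_of_real (h v) * exp (- (\<i> * of_real \<xi> * of_real v))))"
    unfolding fourier_def by (rule integral_norm_bound)
  also have "\<dots> = (LINT v|lebesgue. \<bar>h v\<bar>)"
    by (simp add: norm_mult)
  also have "\<dots> = (LINT v|lebesgue. h v)"
    using assms by (intro integral_cong_AE) auto
  finally show ?thesis .
qed

lemma fourier_rescale:
  assumes "h \<in> borel_measurable lebesgue" and "0 < s"
  shows "fourier (\<lambda>v. s * h (v * s)) \<xi> = fourier h (\<xi> / s)"
proof -
  define k where "k = (\<lambda>v. complex_of_real (h v) * exp (- (\<i> * of_real (\<xi> / s) * of_real v)))"
  have "(\<lambda>v::real. exp (- (\<i> * of_real (\<xi> / s) * of_real v))) \<in> borel_measurable borel"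
    by (intro borel_measurable_continuous_onI continuous_intros) 
  then have "(\<lambda>v::real. exp (- (\<i> * of_real (\<xi> / s) * of_real v))) \<in> borel_measurable lebesgue"
    by (simp add: measurable_completion)
  then have k[measurable]: "k \<in> borel_measurable lebesgue"
    unfolding k_def by (intro borel_measurable_times measurable_compose[OF assms(1) borel_measurable_of_real]) auto
  have T: "(\<lambda>x. 0 + s * x) \<in> lebesgue \<rightarrow>\<^sub>M lebesgue"
    using lebesgue_affine_measurable[where c = "\<lambda>_::real. s" and t = 0] assms(2) by simp
  have "fourier h (\<xi> / s) = integral\<^sup>L (density (distr lebesgue lebesgue (\<lambda>x. 0 + s * x)) (\<lambda>_. ennreal s)) k"
    unfolding fourier_def k_def[symmetric] using lebesgue_real_affine[of s 0] assms(2) by simp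
  also have "\<dots> = integral\<^sup>L (distr lebesgue lebesgue (\<lambda>x. 0 + s * x)) (\<lambda>v. s *\<^sub>R k v)"
    using assms(2) by (intro integral_density) auto
  also have "\<dots> = (LINT v|lebesgue. s *\<^sub>R k (0 + s * v))"
    by (rule integral_distr[OF T]) measurable
  also have "\<dots> = fourier (\<lambda>v. s * h (v * s)) \<xi>"
    unfolding fourier_def k_def using assms(2)
    by (intro Bochner_Integration.integral_cong) (auto simp: scaleR_conv_of_real mult_ac)
  finally show ?thesis ..
qed

lemma exp_taylor_first:
  fixes x :: real
  shows "cmod (exp (- (\<i> * of_real x)) - 1 + \<i> * of_real x) \<le> x\<^sup>2 / 2"
  using iexp_approx1[of "- x" 1] by (simp add: algebra_simps power2_eq_square)

text \<open>The Taylor error is at most \<open>|x|\<^sup>3 / 6\<close> and at most \<open>x\<^sup>2\<close>; one of the two suffices for each size of \<open>x\<close>.\<close>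

lemma exp_taylor_second:
  fixes x :: real
  assumes "0 \<le> \<delta>" "\<delta> \<le> 1"
  shows "cmod (exp (- (\<i> * of_real x)) - 1 + \<i> * of_real x + of_real (x\<^sup>2 / 2)) \<le> \<bar>x\<bar> powr (2 + \<delta>)"
    (is "cmod ?d \<le> _")
proof -
  have sum: "exp (\<i> * complex_of_real (- x)) - (\<Sum>k\<le>2. (\<i> * complex_of_real (- x)) ^ k / fact k) = ?d"
    by (simp add: numeral_2_eq_2 power2_eq_square algebra_simps)
  have 3: "cmod ?d \<le> \<bar>x\<bar> ^ 3 / 6" and 2: "cmod ?d \<le> \<bar>x\<bar> ^ 2"
    using iexp_approx1[of "- x" 2] iexp_approx2[of "- x" 2] unfolding sum
    by (simp_all add: eval_nat_numeral)
  show ?thesis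
  proof (cases "x = 0")
    case False
    show ?thesis
    proof (cases "\<bar>x\<bar> \<le> 1")
      case True
      have "\<bar>x\<bar> ^ 3 = \<bar>x\<bar> powr 3" using False by (simp add: powr_numeral)
      also have "\<dots> \<le> \<bar>x\<bar> powr (2 + \<delta>)" using True assms by (intro powr_mono') auto
      finally show ?thesis using 3 zero_le_power[of "\<bar>x\<bar>" 3] by linarith
    next
      case big: False
      have "\<bar>x\<bar> ^ 2 = \<bar>x\<bar> powr 2" using False by (simp add: powr_numeral)
      also have "\<dots> \<le> \<bar>x\<bar> powr (2 + \<delta>)" using big assms by (intro powr_mono) auto
      finally show ?thesis using 2 by linarith
    qed
  qed simp
qed

lemma one_minus_cos_le: "1 - cos x \<le> x\<^sup>2 / 2" for x :: real
  using exp_taylor_first[of x] abs_Re_le_cmod[of "exp (- (\<i> * of_real x)) - 1 + \<i> * of_real x"]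
  by (simp add: Re_exp)

lemma difference_quotient_cos_tendsto:
  fixes v :: real
  shows "(\<lambda>n. 2 * (real (Suc n))\<^sup>2 * (1 - cos (v / real (Suc n)))) \<longlonglongrightarrow> v\<^sup>2"
proof (rule LIM_zero_cancel, rule Lim_null_comparison)
  show "\<forall>\<^sub>F n in sequentially. norm (2 * (real (Suc n))\<^sup>2 * (1 - cos (v / real (Suc n))) - v\<^sup>2)
          \<le> 2 * \<bar>v\<bar> ^ 3 / real (Suc n)"
  proof (intro always_eventually allI)
    fix n
    define N where "N = real (Suc n)"
    have N: "0 < N" by (simp add: N_def)
    define x where "x = v / N"
    have v: "v = N * x" using N by (simp add: x_def)
    have "\<bar>cos x - 1 + x\<^sup>2 / 2\<bar> \<le> \<bar>x\<bar> powr 3"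
      using exp_taylor_second[of 1 x] abs_Re_le_cmod[of "exp (- (\<i> * of_real x)) - 1 + \<i> * of_real x + of_real (x\<^sup>2 / 2)"]
      by (simp add: Re_exp)
    also have "\<dots> = \<bar>x\<bar> ^ 3" by (cases "x = 0") (simp_all add: powr_numeral)
    finally have "2 * N\<^sup>2 * \<bar>cos x - 1 + x\<^sup>2 / 2\<bar> \<le> 2 * N\<^sup>2 * \<bar>x\<bar> ^ 3"
      using N by (intro mult_left_mono) auto
    moreover have "2 * N\<^sup>2 * \<bar>cos x - 1 + x\<^sup>2 / 2\<bar> = \<bar>2 * N\<^sup>2 * (1 - cos x) - v\<^sup>2\<bar>"
    proof -
      have "2 * N\<^sup>2 * \<bar>cos x - 1 + x\<^sup>2 / 2\<bar> = \<bar>- (2 * N\<^sup>2) * (cos x - 1 + x\<^sup>2 / 2)\<bar>"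
        unfolding abs_mult by simp
      also have "- (2 * N\<^sup>2) * (cos x - 1 + x\<^sup>2 / 2) = 2 * N\<^sup>2 * (1 - cos x) - v\<^sup>2"
        by (simp add: v power_mult_distrib algebra_simps)
      finally show ?thesis .
    qed
    moreover have "2 * N\<^sup>2 * \<bar>x\<bar> ^ 3 = 2 * \<bar>v\<bar> ^ 3 / N"
      using N by (simp add: x_def power_divide abs_divide field_simps power2_eq_square power3_eq_cube)
    ultimately have "\<bar>2 * N\<^sup>2 * (1 - cos x) - v\<^sup>2\<bar> \<le> 2 * \<bar>v\<bar> ^ 3 / N"
      by linarith
    then show "norm (2 * (real (Suc n))\<^sup>2 * (1 - cos (v / real (Suc n))) - v\<^sup>2) \<le> 2 * \<bar>v\<bar> ^ 3 / real (Suc n)"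
      unfolding x_def N_def real_norm_def .
  qed
  show "(\<lambda>n. 2 * \<bar>v\<bar> ^ 3 / real (Suc n)) \<longlonglongrightarrow> 0"
    using LIMSEQ_Suc[OF lim_const_over_n[of "2 * \<bar>v\<bar> ^ 3"]] by simp
qed

lemma integrable_cos:
  fixes h :: "real \<Rightarrow> real"
  assumes "integrable lebesgue h"
  shows "integrable lebesgue (\<lambda>v. h v * cos (\<xi> * v - \<theta>))"
proof (rule Bochner_Integration.integrable_bound[OF assms])
  have "(\<lambda>v. cos (\<xi> * v - \<theta>)) \<in> borel_measurable borel"
    by (intro borel_measurable_continuous_onI continuous_intros)
  then have "(\<lambda>v. cos (\<xi> * v - \<theta>)) \<in> borel_measurable lebesgue"
    by (simp add: measurable_completion)
  with assms show "(\<lambda>v. h v * cos (\<xi> * v - \<theta>)) \<in> borel_measurable lebesgue"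
    by (intro borel_measurable_times) auto
  show "AE v in lebesgue. norm (h v * cos (\<xi> * v - \<theta>)) \<le> norm (h v)"
    using abs_cos_le_one by (auto simp: abs_mult intro!: mult_left_le)
qed

lemma Re_rotated_fourier:
  fixes h :: "real \<Rightarrow> real"
  assumes "integrable lebesgue h"
  shows "Re (cis \<theta> * fourier h \<xi>) = (LINT v|lebesgue. h v * cos (\<xi> * v - \<theta>))"
proof -
  have eq: "cis \<theta> * (complex_of_real (h v) * exp (- (\<i> * of_real \<xi> * of_real v)))
      = complex_of_real (h v) * cis (- (\<xi> * v - \<theta>))" for v
    by (simp add: cis_conv_exp exp_add[symmetric] exp_diff field_simps exp_minus)
  have "cis \<theta> * fourier h \<xi> = (LINT v|lebesgue. complex_of_real (h v) * cis (- (\<xi> * v - \<theta>)))"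
    unfolding fourier_def eq[symmetric] by (rule integral_mult_right_zero[symmetric])
  moreover have "integrable lebesgue (\<lambda>v. complex_of_real (h v) * cis (- (\<xi> * v - \<theta>)))"
    unfolding eq[symmetric] by (intro integrable_mult_right integrable_fourier assms)
  ultimately have "Re (cis \<theta> * fourier h \<xi>) = (LINT v|lebesgue. Re (complex_of_real (h v) * cis (- (\<xi> * v - \<theta>))))"
    by (metis integral_Re)
  then have "Re (cis \<theta> * fourier h \<xi>) = (LINT v|lebesgue. h v * cos (- (\<xi> * v - \<theta>)))"
    by (simp only: times_complex.sel complex_of_real_def complex.sel cis.sel mult_zero_left diff_zero)
  then show ?thesis by (simp only: cos_minus)
qed

text \<open>Integrability of \<open>v\<^sup>2 h v\<close> has to come first, since otherwise the integral is \<open>0\<close> by default. The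
difference quotients in the hypothesis are the integrals of \<open>2 N\<^sup>2 (1 - cos (v / N)) h v\<close>, and these integrands tend to \<open>v\<^sup>2 h v\<close> from below. Fatou's
lemma makes the limit integrable, and it then dominates the sequence.\<close>

lemma second_moment_eqI:
  fixes h :: "real \<Rightarrow> real"
  assumes h: "integrable lebesgue h" "AE v in lebesgue. 0 \<le> h v" "(LINT v|lebesgue. h v) = 1"
    and lim: "(\<lambda>n. 2 * (real (Suc n))\<^sup>2 * (1 - Re (fourier h (1 / real (Suc n))))) \<longlonglongrightarrow> E"
  shows "second_moment h = E"
proof -
  define \<phi> where "\<phi> = (\<lambda>n v. 2 * (real (Suc n))\<^sup>2 * (1 - cos (v / real (Suc n))) * h v)"
  have \<phi>_alt: "\<phi> n v = 2 * (real (Suc n))\<^sup>2 * (h v - h v * cos (1 / real (Suc n) * v - 0))" for n v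
    by (simp add: \<phi>_def algebra_simps)
  have \<phi>_int: "integrable lebesgue (\<phi> n)" for n
    unfolding \<phi>_alt[abs_def] by (intro integrable_mult_right Bochner_Integration.integrable_diff h integrable_cos)
  have \<phi>_val: "integral\<^sup>L lebesgue (\<phi> n) = 2 * (real (Suc n))\<^sup>2 * (1 - Re (fourier h (1 / real (Suc n))))" for n
    using Re_rotated_fourier[OF h(1), of 0 "1 / real (Suc n)"] integrable_cos[OF h(1), of "1 / real (Suc n)" 0]
    unfolding \<phi>_alt[abs_def] by (simp add: h(1,3) Bochner_Integration.integral_diff[OF h(1)] del: of_nat_Suc)
  have \<phi>_lim: "(\<lambda>n. \<phi> n v) \<longlonglongrightarrow> v\<^sup>2 * h v" for v
    unfolding \<phi>_def by (intro tendsto_mult_right difference_quotient_cos_tendsto)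
  have \<phi>_nonneg: "AE v in lebesgue. 0 \<le> \<phi> n v" for n
    using h(2) by eventually_elim (auto simp: \<phi>_def)
  have \<phi>_le: "AE v in lebesgue. norm (\<phi> n v) \<le> v\<^sup>2 * h v" for n
    using h(2) \<phi>_nonneg[of n]
  proof eventually_elim
    case (elim v)
    have "2 * (real (Suc n))\<^sup>2 * (1 - cos (v / real (Suc n))) \<le> 2 * (real (Suc n))\<^sup>2 * ((v / real (Suc n))\<^sup>2 / 2)"
      by (intro mult_left_mono one_minus_cos_le) auto
    also have "\<dots> = v\<^sup>2" by (simp add: power_divide)
    finally show ?case using elim by (auto simp: \<phi>_def intro!: mult_right_mono)
  qed
  have meas: "(\<lambda>v. v\<^sup>2 * h v) \<in> borel_measurable lebesgue"
    by (rule borel_measurable_LIMSEQ_real[OF \<phi>_lim borel_measurable_integrable[OF \<phi>_int]])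
  have "(\<integral>\<^sup>+ v. ennreal (v\<^sup>2 * h v) \<partial>lebesgue) = (\<integral>\<^sup>+ v. liminf (\<lambda>n. ennreal (\<phi> n v)) \<partial>lebesgue)"
    using \<phi>_lim by (intro nn_integral_cong lim_imp_Liminf[symmetric]) (auto intro!: tendsto_ennrealI)
  also have "\<dots> \<le> liminf (\<lambda>n. \<integral>\<^sup>+ v. ennreal (\<phi> n v) \<partial>lebesgue)"
    using borel_measurable_integrable[OF \<phi>_int]
    by (intro nn_integral_liminf measurable_compose[OF _ measurable_ennreal])
  also have "\<dots> = liminf (\<lambda>n. ennreal (integral\<^sup>L lebesgue (\<phi> n)))"
    using \<phi>_int \<phi>_nonneg by (simp add: nn_integral_eq_integral)
  also have "\<dots> = ennreal E"
    using lim unfolding \<phi>_val by (intro lim_imp_Liminf tendsto_ennrealI) auto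
  finally have "(\<integral>\<^sup>+ v. ennreal (v\<^sup>2 * h v) \<partial>lebesgue) < \<infinity>"
    by (simp add: order_le_less_trans)
  moreover have "AE v in lebesgue. 0 \<le> v\<^sup>2 * h v" using h(2) by auto
  ultimately have "integrable lebesgue (\<lambda>v. v\<^sup>2 * h v)"
    using meas by (intro integrableI_nonneg)
  then have "(\<lambda>n. integral\<^sup>L lebesgue (\<phi> n)) \<longlonglongrightarrow> second_moment h"
    unfolding second_moment_def using \<phi>_int \<phi>_lim \<phi>_le meas
    by (intro integral_dominated_convergence[where w = "\<lambda>v. v\<^sup>2 * h v"]) auto
  with lim show ?thesis unfolding \<phi>_val by (rule LIMSEQ_unique[symmetric])
qed

text \<open>Rotate so that \<open>fourier h \<xi>\<close> becomes a nonnegative real. Then the claim is the integral of the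
pointwise inequality \<open>1 - cos (2 y) \<le> 4 (1 - cos y)\<close>.\<close>

lemma one_minus_cmod_fourier_double:
  fixes h :: "real \<Rightarrow> real"
  assumes h: "integrable lebesgue h" "AE v in lebesgue. 0 \<le> h v" "(LINT v|lebesgue. h v) = 1"
  shows "1 - cmod (fourier h (2 * \<xi>)) \<le> 4 * (1 - cmod (fourier h \<xi>))"
proof -
  define \<theta> where "\<theta> = - Arg (fourier h \<xi>)"
  have one_minus: "(LINT v|lebesgue. h v * (1 - cos (\<xi> * v - \<theta>))) = 1 - Re (cis \<theta> * fourier h \<xi>)" for \<xi> \<theta> :: real
    unfolding Re_rotated_fourier[OF h(1)] using h(1,3) integrable_cos[OF h(1)]
    by (simp add: right_diff_distrib)
  have int: "integrable lebesgue (\<lambda>v. h v * (1 - cos (\<xi> * v - \<theta>)))" for \<xi> \<theta> :: real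
    using h(1) integrable_cos[OF h(1)] by (simp add: right_diff_distrib)
  have "cis \<theta> * fourier h \<xi> = of_real (cmod (fourier h \<xi>))"
  proof -
    have "cis \<theta> * rcis (cmod (fourier h \<xi>)) (Arg (fourier h \<xi>)) = of_real (cmod (fourier h \<xi>))"
      by (simp add: \<theta>_def rcis_def cis_mult mult.left_commute)
    then show ?thesis by (simp only: rcis_cmod_Arg)
  qed
  then have single: "Re (cis \<theta> * fourier h \<xi>) = cmod (fourier h \<xi>)" by simp
  have "Re (cis (2 * \<theta>) * fourier h (2 * \<xi>)) \<le> cmod (fourier h (2 * \<xi>))"
    using complex_Re_le_cmod[of "cis (2 * \<theta>) * fourier h (2 * \<xi>)"] by (simp add: norm_mult)
  then have "1 - cmod (fourier h (2 * \<xi>)) \<le> (LINT v|lebesgue. h v * (1 - cos (2 * \<xi> * v - 2 * \<theta>)))"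
    unfolding one_minus by simp
  also have "\<dots> \<le> (LINT v|lebesgue. 4 * (h v * (1 - cos (\<xi> * v - \<theta>))))"
  proof (rule integral_mono_AE)
    show "AE v in lebesgue. h v * (1 - cos (2 * \<xi> * v - 2 * \<theta>)) \<le> 4 * (h v * (1 - cos (\<xi> * v - \<theta>)))"
      using h(2)
    proof eventually_elim
      case (elim v)
      define c where "c = cos (\<xi> * v - \<theta>)"
      have "cos (2 * \<xi> * v - 2 * \<theta>) = 2 * c\<^sup>2 - 1"
        unfolding c_def cos_double_cos[symmetric] by (simp add: algebra_simps)
      moreover have "0 \<le> (1 - c)\<^sup>2" by simp
      ultimately have "1 - cos (2 * \<xi> * v - 2 * \<theta>) \<le> 4 * (1 - c)"
        by (simp add: power2_eq_square algebra_simps)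
      from mult_left_mono[OF this elim] show ?case by (simp add: c_def mult_ac)
    qed
  qed (use int[of "2 * \<xi>" "2 * \<theta>"] int[of \<xi> \<theta>] in auto)
  also have "\<dots> = 4 * (1 - cmod (fourier h \<xi>))"
    by (simp only: integral_mult_right_zero one_minus single)
  finally show ?thesis .
qed

context
  fixes g :: "real \<Rightarrow> real"
  assumes nonneg: "\<And>v. 0 \<le> g v"
    and mass: "has_bochner_integral lebesgue g 1"
    and mean: "has_bochner_integral lebesgue (\<lambda>v. v * g v) 0"
    and energy: "has_bochner_integral lebesgue (\<lambda>v. v\<^sup>2 * g v) 1"
begin

lemma fourier_taylor_first: "cmod (1 - fourier g \<xi>) \<le> \<xi>\<^sup>2 / 2"
proof -
  let ?d = "\<lambda>v. complex_of_real (g v) * (exp (- (\<i> * of_real (\<xi> * v))) - 1 + \<i> * of_real (\<xi> * v))"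
  have "has_bochner_integral lebesgue (\<lambda>v. complex_of_real (g v) * exp (- (\<i> * of_real \<xi> * of_real v))
      - complex_of_real (g v) + \<i> * of_real \<xi> * complex_of_real (v * g v))
      (fourier g \<xi> - of_real 1 + \<i> * of_real \<xi> * of_real 0)"
    unfolding fourier_def
    by (intro has_bochner_integral_add has_bochner_integral_diff has_bochner_integral_mult_right
        has_bochner_integral_of_real mass mean has_bochner_integral_integrable integrable_fourier
        integrable.intros[OF mass])
  also have "(\<lambda>v. complex_of_real (g v) * exp (- (\<i> * of_real \<xi> * of_real v))
      - complex_of_real (g v) + \<i> * of_real \<xi> * complex_of_real (v * g v)) = ?d"
    by (auto simp: algebra_simps)
  finally have d: "has_bochner_integral lebesgue ?d (fourier g \<xi> - 1)" by simp
  have "norm (integral\<^sup>L lebesgue ?d) \<le> (LINT v|lebesgue. \<xi>\<^sup>2 / 2 * (v\<^sup>2 * g v))"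
  proof (rule Bochner_Integration.integral_norm_bound_integral)
    show "norm (?d v) \<le> \<xi>\<^sup>2 / 2 * (v\<^sup>2 * g v)" for v
      using mult_left_mono[OF exp_taylor_first[of "\<xi> * v"] nonneg[of v]] nonneg[of v]
      by (simp add: norm_mult power_mult_distrib mult_ac)
  qed (use d energy in \<open>auto simp: has_bochner_integral_iff\<close>)
  then show ?thesis
    using d energy by (simp add: has_bochner_integral_iff norm_minus_commute)
qed

lemma fourier_taylor_second:
  assumes \<delta>: "0 \<le> \<delta>" "\<delta> \<le> 1"
    and moment: "integrable lebesgue (\<lambda>v. \<bar>v\<bar> powr (2 + \<delta>) * g v)"
  shows "cmod (fourier g \<xi> - 1 + of_real (\<xi>\<^sup>2 / 2))
    \<le> (LINT v|lebesgue. \<bar>v\<bar> powr (2 + \<delta>) * g v) * \<bar>\<xi>\<bar> powr (2 + \<delta>)"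
proof -
  let ?d = "\<lambda>v. complex_of_real (g v) * (exp (- (\<i> * of_real (\<xi> * v))) - 1 + \<i> * of_real (\<xi> * v) + of_real ((\<xi> * v)\<^sup>2 / 2))"
  have "has_bochner_integral lebesgue (\<lambda>v. complex_of_real (g v) * exp (- (\<i> * of_real \<xi> * of_real v))
      - complex_of_real (g v) + \<i> * of_real \<xi> * complex_of_real (v * g v)
      + of_real (\<xi>\<^sup>2 / 2) * complex_of_real (v\<^sup>2 * g v))
      (fourier g \<xi> - of_real 1 + \<i> * of_real \<xi> * of_real 0 + of_real (\<xi>\<^sup>2 / 2) * of_real 1)"
    unfolding fourier_def
    by (intro has_bochner_integral_add has_bochner_integral_diff has_bochner_integral_mult_right
        has_bochner_integral_of_real mass mean energy has_bochner_integral_integrable integrable_fourier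
        integrable.intros[OF mass])
  also have "(\<lambda>v. complex_of_real (g v) * exp (- (\<i> * of_real \<xi> * of_real v))
      - complex_of_real (g v) + \<i> * of_real \<xi> * complex_of_real (v * g v)
      + of_real (\<xi>\<^sup>2 / 2) * complex_of_real (v\<^sup>2 * g v)) = ?d"
    by (auto simp: algebra_simps power_mult_distrib)
  finally have d: "has_bochner_integral lebesgue ?d (fourier g \<xi> - 1 + of_real (\<xi>\<^sup>2 / 2))" by simp
  have "norm (integral\<^sup>L lebesgue ?d) \<le> (LINT v|lebesgue. (\<bar>v\<bar> powr (2 + \<delta>) * g v) * \<bar>\<xi>\<bar> powr (2 + \<delta>))"
  proof (rule Bochner_Integration.integral_norm_bound_integral)
    show "norm (?d v) \<le> (\<bar>v\<bar> powr (2 + \<delta>) * g v) * \<bar>\<xi>\<bar> powr (2 + \<delta>)" for v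
      using mult_left_mono[OF exp_taylor_second[OF \<delta>, of "\<xi> * v"] nonneg[of v]] nonneg[of v]
      by (simp only: norm_mult norm_of_real abs_of_nonneg abs_mult powr_mult mult_ac)
  qed (use d moment in \<open>auto simp: has_bochner_integral_iff\<close>)
  then show ?thesis
    using d by (simp add: has_bochner_integral_iff)
qed

end

lemma integrable_lower_moment:
  fixes g :: "real \<Rightarrow> real"
  assumes g: "\<And>v. 0 \<le> g v" "integrable lebesgue g"
    and "integrable lebesgue (\<lambda>v. v\<^sup>2 * g v)" "integrable lebesgue (\<lambda>v. \<bar>v\<bar> powr b * g v)"
    and ab: "2 \<le> a" "a \<le> b"
  shows "integrable lebesgue (\<lambda>v. \<bar>v\<bar> powr a * g v)"
proof (rule Bochner_Integration.integrable_bound[OF Bochner_Integration.integrable_add[OF assms(3,4)]])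
  have "(\<lambda>v::real. \<bar>v\<bar> powr a) \<in> borel_measurable lebesgue"
    by (intro measurable_completion) measurable
  with g(2) show "(\<lambda>v. \<bar>v\<bar> powr a * g v) \<in> borel_measurable lebesgue"
    by (intro borel_measurable_times) auto
  have le: "\<bar>v\<bar> powr a \<le> v\<^sup>2 + \<bar>v\<bar> powr b" for v :: real
  proof (cases "v = 0")
    case False
    have sq: "\<bar>v\<bar> powr 2 = v\<^sup>2" using False by simp
    show ?thesis
    proof (cases "\<bar>v\<bar> \<le> 1")
      case True
      then have "\<bar>v\<bar> powr a \<le> v\<^sup>2"
        unfolding sq[symmetric] using ab by (intro powr_mono') auto
      then show ?thesis using powr_ge_zero[of "\<bar>v\<bar>" b] by linarith
    next
      case False
      then have "\<bar>v\<bar> powr a \<le> \<bar>v\<bar> powr b" using ab by (intro powr_mono) auto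
      then show ?thesis using zero_le_power2[of v] by linarith
    qed
  qed simp
  show "AE v in lebesgue. norm (\<bar>v\<bar> powr a * g v) \<le> norm (v\<^sup>2 * g v + \<bar>v\<bar> powr b * g v)"
    using mult_right_mono[OF le g(1)] g(1) by (auto simp: distrib_right)
qed

text \<open>For \<open>|\<xi>|\<close> between \<open>\<rho>\<close> and \<open>R\<close>, some \<open>2^k \<xi>\<close> lies beyond \<open>R\<close>, where the modulus is bounded away from \<open>1\<close>. Running
the doubling inequality backwards bounds it away from \<open>1\<close> at \<open>\<xi>\<close>, with a gap that is the same for all \<open>\<xi>\<close>, as one \<open>k\<close> works for all; \<open>\<kappa>\<close> then
has to fit this gap and the given tail.\<close>

lemma fourier_uniform_tail:
  fixes h :: "real \<Rightarrow> real"
  assumes h: "integrable lebesgue h" "AE v in lebesgue. 0 \<le> h v" "(LINT v|lebesgue. h v) = 1"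
    and pos: "0 < R" "0 < \<beta>" "0 < m" "0 < \<rho>" and "m \<le> \<nu>"
    and decay: "\<And>\<xi>. \<bar>\<xi>\<bar> > R \<Longrightarrow> cmod (fourier h \<xi>) \<le> exp (- \<beta> * \<bar>\<xi>\<bar> powr \<nu>)"
  obtains \<kappa> where "0 < \<kappa>"
    "\<And>\<xi>. \<bar>\<xi>\<bar> > \<rho> \<Longrightarrow> cmod (fourier h \<xi>) \<le> exp (- \<kappa> * \<bar>\<xi>\<bar> powr m)"
proof -
  have iterate: "1 - cmod (fourier h (2 ^ k * \<xi>)) \<le> 4 ^ k * (1 - cmod (fourier h \<xi>))" for k \<xi>
  proof (induction k)
    case (Suc k)
    show ?case
      using one_minus_cmod_fourier_double[OF h, of "2 ^ k * \<xi>"] Suc by (simp add: mult.assoc)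
  qed simp
  obtain k :: nat where "R / \<rho> < 2 ^ k"
    using real_arch_pow[of 2 "R / \<rho>"] by auto
  then have k: "R < 2 ^ k * \<rho>" using pos by (simp add: field_simps)
  define \<tau> where "\<tau> = (1 - exp (- \<beta> * R powr \<nu>)) / 4 ^ k"
  have "0 < \<tau>" using pos by (simp add: \<tau>_def)
  have gap: "cmod (fourier h \<xi>) \<le> exp (- \<tau>)" if "\<bar>\<xi>\<bar> > \<rho>" for \<xi>
  proof -
    have "2 ^ k * \<rho> < 2 ^ k * \<bar>\<xi>\<bar>" using that by simp
    with k have "R < 2 ^ k * \<bar>\<xi>\<bar>" by linarith
    then have "R < \<bar>2 ^ k * \<xi>\<bar>" by (simp add: abs_mult)
    then have "cmod (fourier h (2 ^ k * \<xi>)) \<le> exp (- \<beta> * \<bar>2 ^ k * \<xi>\<bar> powr \<nu>)"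
      by (rule decay)
    also have "\<dots> \<le> exp (- \<beta> * R powr \<nu>)"
      using \<open>R < \<bar>2 ^ k * \<xi>\<bar>\<close> pos \<open>m \<le> \<nu>\<close> by (simp add: powr_mono2)
    finally have "1 - exp (- \<beta> * R powr \<nu>) \<le> 4 ^ k * (1 - cmod (fourier h \<xi>))"
      using iterate[of k \<xi>] by linarith
    then have "\<tau> \<le> 1 - cmod (fourier h \<xi>)"
      by (simp add: \<tau>_def divide_le_eq mult.commute)
    then show ?thesis using exp_ge_add_one_self[of "- \<tau>"] by linarith
  qed
  define \<kappa> where "\<kappa> = min (\<beta> * R powr (\<nu> - m)) (\<tau> / R powr m)"
  have "0 < \<kappa>" using pos \<open>0 < \<tau>\<close> by (simp add: \<kappa>_def)
  moreover have "cmod (fourier h \<xi>) \<le> exp (- \<kappa> * \<bar>\<xi>\<bar> powr m)" if "\<bar>\<xi>\<bar> > \<rho>" for \<xi>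
  proof (cases "\<bar>\<xi>\<bar> > R")
    case True
    have "\<kappa> * \<bar>\<xi>\<bar> powr m \<le> \<beta> * \<bar>\<xi>\<bar> powr (\<nu> - m) * \<bar>\<xi>\<bar> powr m"
    proof (intro mult_right_mono)
      have "R powr (\<nu> - m) \<le> \<bar>\<xi>\<bar> powr (\<nu> - m)"
        using True pos \<open>m \<le> \<nu>\<close> by (intro powr_mono2) auto
      with pos have "\<beta> * R powr (\<nu> - m) \<le> \<beta> * \<bar>\<xi>\<bar> powr (\<nu> - m)" by simp
      then show "\<kappa> \<le> \<beta> * \<bar>\<xi>\<bar> powr (\<nu> - m)" by (simp add: \<kappa>_def)
    qed simp
    also have "\<dots> = \<beta> * \<bar>\<xi>\<bar> powr \<nu>" by (simp add: powr_add[symmetric] mult.assoc)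
    finally show ?thesis using decay[OF True] by (auto elim!: order_trans)
  next
    case False
    have "\<kappa> * \<bar>\<xi>\<bar> powr m \<le> \<tau> / R powr m * R powr m"
      using False pos \<open>0 < \<tau>\<close> by (intro mult_mono powr_mono2) (auto simp: \<kappa>_def)
    also have "\<dots> = \<tau>" using pos by simp
    finally show ?thesis using gap[OF that] by (auto elim!: order_trans)
  qed
  ultimately show ?thesis using that by blast
qed

section \<open>The Fourier transform of the unscaled solution\<close>

locale dissipative_flow =
  fixes p q :: real and g :: "real \<Rightarrow> real" and f :: "real \<Rightarrow> real \<Rightarrow> real"
  assumes q_pos: "0 < q" and q_le_p: "q \<le> p" and dissipative: "p\<^sup>2 + q\<^sup>2 < 1"
    and g_nonneg: "\<And>v. 0 \<le> g v"
    and g_mass: "has_bochner_integral lebesgue g 1"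
    and g_mean: "has_bochner_integral lebesgue (\<lambda>v. v * g v) 0"
    and g_energy: "has_bochner_integral lebesgue (\<lambda>v. v\<^sup>2 * g v) 1"
    and solution: "weak_solution p q g f"
begin

definition F :: "real \<Rightarrow> real \<Rightarrow> complex" where
  "F \<xi> t = fourier (f t) \<xi>"

text \<open>The square root of the second moment at time \<open>t\<close>; that it is this function is proved in
\<open>second_moment_f\<close>.\<close>

definition s :: "real \<Rightarrow> real" where
  "s t = exp (- ((1 - p\<^sup>2 - q\<^sup>2) / 2) * t)"

lemma p_pos: "0 < p" using q_pos q_le_p by simp

lemma p_less_one: "p < 1" and q_less_one: "q < 1"
proof -
  have "p\<^sup>2 < 1" using dissipative zero_le_power2[of q] by linarith
  then show "p < 1" using p_pos power_less_imp_less_base[of p 2 1] by simp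
  then show "q < 1" using q_le_p by simp
qed

lemma s_pos: "0 < s t" by (simp add: s_def)

lemma s_zero: "s 0 = 1" by (simp add: s_def)

lemma s_antimono: "t \<le> t' \<Longrightarrow> s t' \<le> s t"
  using dissipative by (auto simp: s_def intro!: mult_left_mono_neg)

lemma s_le_one: "0 \<le> t \<Longrightarrow> s t \<le> 1"
  using s_antimono[of 0 t] by (simp add: s_zero)

lemma s_powr: "s t powr a = exp (- ((1 - p\<^sup>2 - q\<^sup>2) / 2 * a) * t)"
  by (simp add: s_def powr_def algebra_simps)

lemma integrable_f: "0 \<le> t \<Longrightarrow> integrable lebesgue (f t)"
  using solution by (auto simp: weak_solution_def C1_L1_def)

lemma f_nonneg: "0 \<le> t \<Longrightarrow> AE v in lebesgue. 0 \<le> f t v"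
  using solution by (auto simp: weak_solution_def)

lemma F_derivative:
  "0 \<le> t \<Longrightarrow> (F \<xi> has_vector_derivative (F (p * \<xi>) t * F (q * \<xi>) t - F \<xi> t)) (at t within {0..})"
  using solution by (auto simp: weak_solution_def F_def[abs_def])

lemma F_initial: "F \<xi> 0 = fourier g \<xi>"
  using solution by (auto simp: weak_solution_def F_def)

lemma f_mass: 
  assumes "0 \<le> t"
  shows "(LINT v|lebesgue. f t v) = 1"
proof -
  define m where "m t = (LINT v|lebesgue. f t v)" for t
  have F0: "F 0 t = of_real (m t)" for t
    by (simp add: F_def m_def fourier_at_zero)
  have "m t = 1"
  proof (rule logistic_stays_at_one[OF _ _ assms])
    have "complex_of_real (m 0) = of_real (LINT v|lebesgue. g v)"
      unfolding F0[symmetric] F_initial by (rule fourier_at_zero)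
    then show "m 0 = 1" using g_mass by (simp add: has_bochner_integral_iff)
    fix t :: real assume "0 \<le> t"
    from bounded_linear.has_vector_derivative[OF bounded_linear_Re F_derivative[OF this, of 0]]
    show "(m has_real_derivative m t * m t - m t) (at t within {0..})"
      by (simp add: F0 has_real_derivative_iff_has_vector_derivative)
  qed
  then show ?thesis by (simp add: m_def)
qed

lemma cmod_F_le_one: "0 \<le> t \<Longrightarrow> cmod (F \<xi> t) \<le> 1"
  using cmod_fourier_le[OF integrable_f f_nonneg, of t \<xi>] by (simp add: f_mass F_def)

text \<open>A product of two numbers of modulus at most one satisfies \<open>|1 - z w| \<le> |1 - z| + |1 - w|\<close>, and
\<open>s(t)\<^sup>2 \<xi>\<^sup>2 / 2\<close> solves the resulting linear equation exactly.\<close>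

lemma cmod_one_minus_F:
  assumes "0 \<le> t"
  shows "cmod (1 - F \<xi> t) \<le> (s t * \<xi>)\<^sup>2 / 2"
proof -
  define c where "c = 1 - p\<^sup>2 - q\<^sup>2"
  have "cmod (1 - F \<xi> t) \<le> exp (- c * t) * \<xi>\<^sup>2 / 2"
  proof (rule linear_comparison[where w = "\<lambda>\<xi> t. 1 - F \<xi> t" and p = p and q = q
        and h = "\<lambda>\<xi> t. 1 - F (p * \<xi>) t * F (q * \<xi>) t" and W = "\<lambda>\<xi> t. exp (- c * t) * \<xi>\<^sup>2 / 2"
        and W' = "\<lambda>\<xi> t. - c * (exp (- c * t) * \<xi>\<^sup>2 / 2)" and \<sigma> = "\<lambda>_ _. 0" and V = "\<lambda>_. 2"])
    fix \<xi> t :: real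
    show "((\<lambda>t. exp (- c * t) * \<xi>\<^sup>2 / 2) has_real_derivative - c * (exp (- c * t) * \<xi>\<^sup>2 / 2)) (at t)"
      by (auto intro!: derivative_eq_intros)
    show "cmod (1 - F \<xi> 0) \<le> exp (- c * 0) * \<xi>\<^sup>2 / 2"
      using fourier_taylor_first[OF g_nonneg g_mass g_mean g_energy, of \<xi>] by (simp add: F_initial)
    assume t: "0 \<le> t"
    show "((\<lambda>t. 1 - F \<xi> t) has_vector_derivative 1 - F (p * \<xi>) t * F (q * \<xi>) t - (1 - F \<xi> t)) (at t within {0..})"
      by (rule has_vector_derivative_eq_rhs[OF has_vector_derivative_diff[OF has_vector_derivative_const F_derivative[OF t]]]) simp
    have "1 - F (p * \<xi>) t * F (q * \<xi>) t = (1 - F (p * \<xi>) t) + F (p * \<xi>) t * (1 - F (q * \<xi>) t)"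
      by (simp add: algebra_simps)
    also have "cmod \<dots> \<le> cmod (1 - F (p * \<xi>) t) + 1 * cmod (1 - F (q * \<xi>) t)"
      by (rule norm_triangle_le, unfold norm_mult, intro add_left_mono mult_right_mono cmod_F_le_one t) simp
    finally show "cmod (1 - F (p * \<xi>) t * F (q * \<xi>) t) \<le> cmod (1 - F (p * \<xi>) t) + cmod (1 - F (q * \<xi>) t) + 0"
      by simp
    show "exp (- c * t) * (p * \<xi>)\<^sup>2 / 2 + exp (- c * t) * (q * \<xi>)\<^sup>2 / 2 + 0
        \<le> exp (- c * t) * \<xi>\<^sup>2 / 2 + - c * (exp (- c * t) * \<xi>\<^sup>2 / 2)"
      by (simp add: c_def power_mult_distrib field_simps)
    show "cmod (1 - F \<xi> t) \<le> 2"
      using norm_triangle_ineq4[of 1 "F \<xi> t"] cmod_F_le_one[OF t, of \<xi>] by simp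
  qed (use assms in auto)
  moreover have "(s t)\<^sup>2 = exp (- c * t)"
    by (simp add: s_def c_def exp_double[symmetric] field_simps)
  ultimately show ?thesis by (simp add: power_mult_distrib)
qed

text \<open>The constant must exceed the one of the initial datum, the \<open>(2 + \<delta>)\<close>-th moment \<open>M\<close>, and the quotient \<open>1 / S\<close> of
the source term by the gap \<open>S = - S_fun p q \<delta>\<close> between the damping rate of \<open>|\<xi>| powr (2 + \<delta>)\<close>
and the decay rate of \<open>s(t) powr (2 + \<delta>)\<close>.\<close>

lemma F_remainder_bound:
  assumes \<delta>: "0 < \<delta>" "\<delta> \<le> 1" and S: "S_fun p q \<delta> < 0"
    and moment: "integrable lebesgue (\<lambda>v. \<bar>v\<bar> powr (2 + \<delta>) * g v)"
  obtains C where "0 \<le> C"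
    "\<And>\<xi> t. 0 \<le> t \<Longrightarrow> cmod (F \<xi> t - 1 + of_real ((s t * \<xi>)\<^sup>2 / 2)) \<le> C * \<bar>s t * \<xi>\<bar> powr (2 + \<delta>)"
proof -
  define a where "a = 2 + \<delta>"
  define c where "c = 1 - p\<^sup>2 - q\<^sup>2"
  define S where "S = - S_fun p q \<delta>"
  have "0 < S" using S by (simp add: S_def)
  have S_eq: "S = 1 - c / 2 * a - p powr a - q powr a"
    by (simp add: S_def S_fun_def a_def c_def field_simps)
  define M where "M = (LINT v|lebesgue. \<bar>v\<bar> powr a * g v)"
  have "0 \<le> M" unfolding M_def by (intro Bochner_Integration.integral_nonneg) (auto simp: g_nonneg)
  define C where "C = M + 1 / S"
  have "0 \<le> C" and MC: "M \<le> C" and CS: "1 \<le> C * S"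
    using \<open>0 \<le> M\<close> \<open>0 < S\<close> by (auto simp: C_def field_simps)
  have powr_eq: "\<bar>s t * \<xi>\<bar> powr a = exp (- (c / 2 * a) * t) * \<bar>\<xi>\<bar> powr a" for t \<xi>
    using s_pos[of t] by (simp add: abs_mult powr_mult s_powr c_def)
  have sq_eq: "(s t * \<xi>)\<^sup>2 = exp (- c * t) * \<xi>\<^sup>2" for t \<xi>
    by (simp add: s_def c_def power_mult_distrib exp_double[symmetric] field_simps)
  define w where "w \<xi> t = F \<xi> t - 1 + of_real (exp (- c * t) * \<xi>\<^sup>2 / 2)" for \<xi> t
  define h where "h \<xi> t = w (p * \<xi>) t + w (q * \<xi>) t + (1 - F (p * \<xi>) t) * (1 - F (q * \<xi>) t)" for \<xi> t
  have "cmod (w \<xi> t) \<le> C * exp (- (c / 2 * a) * t) * \<bar>\<xi>\<bar> powr a" if "0 \<le> t" for \<xi> t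
  proof (rule linear_comparison[where w = w and h = h and p = p and q = q
        and W = "\<lambda>\<xi> t. C * exp (- (c / 2 * a) * t) * \<bar>\<xi>\<bar> powr a"
        and W' = "\<lambda>\<xi> t. - (c / 2 * a) * (C * exp (- (c / 2 * a) * t) * \<bar>\<xi>\<bar> powr a)"
        and \<sigma> = "\<lambda>\<xi> t. \<bar>s t * \<xi>\<bar> powr a" and V = "\<lambda>\<xi>. 2 + \<xi>\<^sup>2"])
    fix \<xi> t :: real
    show "((\<lambda>t. C * exp (- (c / 2 * a) * t) * \<bar>\<xi>\<bar> powr a) has_real_derivative
        - (c / 2 * a) * (C * exp (- (c / 2 * a) * t) * \<bar>\<xi>\<bar> powr a)) (at t)"
    proof -
      have "((\<lambda>t. C * exp (- b * t) * K) has_real_derivative - b * (C * exp (- b * t) * K)) (at t)" for b K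
        by (auto intro!: derivative_eq_intros)
      then show ?thesis .
    qed
    have "cmod (w \<xi> 0) \<le> M * \<bar>\<xi>\<bar> powr a"
      using fourier_taylor_second[OF g_nonneg g_mass g_mean g_energy _ \<delta>(2) moment, of \<xi>] \<delta>(1)
      by (simp add: w_def F_initial a_def M_def)
    also have "\<dots> \<le> C * \<bar>\<xi>\<bar> powr a" using MC by (intro mult_right_mono) auto
    finally show "cmod (w \<xi> 0) \<le> C * exp (- (c / 2 * a) * 0) * \<bar>\<xi>\<bar> powr a" by simp
    show "2 + (p * \<xi>)\<^sup>2 \<le> 2 + \<xi>\<^sup>2" and "2 + (q * \<xi>)\<^sup>2 \<le> 2 + \<xi>\<^sup>2"
      using p_pos q_pos p_less_one q_less_one by (auto simp: power_mult_distrib intro!: mult_left_le_one_le power_le_one)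
    assume t: "0 \<le> t"
    have dG: "((\<lambda>t. of_real (exp (- c * t) * \<xi>\<^sup>2 / 2)) has_vector_derivative
        complex_of_real (- c * (exp (- c * t) * \<xi>\<^sup>2 / 2))) (at t within {0..})"
      by (intro has_vector_derivative_of_real)
         (auto intro!: derivative_eq_intros simp: has_real_derivative_iff_has_vector_derivative[symmetric])
    have "((\<lambda>t. F \<xi> t - 1 + of_real (exp (- c * t) * \<xi>\<^sup>2 / 2)) has_vector_derivative
        F (p * \<xi>) t * F (q * \<xi>) t - F \<xi> t - 0 + of_real (- c * (exp (- c * t) * \<xi>\<^sup>2 / 2))) (at t within {0..})"
      by (intro has_vector_derivative_add has_vector_derivative_diff has_vector_derivative_const F_derivative t dG)
    moreover have "F (p * \<xi>) t * F (q * \<xi>) t - F \<xi> t - 0 + of_real (- c * (exp (- c * t) * \<xi>\<^sup>2 / 2)) = h \<xi> t - w \<xi> t"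
    proof -
      define G where "G = complex_of_real (exp (- c * t) * \<xi>\<^sup>2 / 2)"
      have G: "complex_of_real (exp (- c * t) * (r * \<xi>)\<^sup>2 / 2) = of_real (r\<^sup>2) * G" for r
        unfolding G_def of_real_mult[symmetric] by (simp only: power_mult_distrib times_divide_eq_right mult_ac)
      have c: "complex_of_real (- c * (exp (- c * t) * \<xi>\<^sup>2 / 2)) = - (1 - of_real (p\<^sup>2) - of_real (q\<^sup>2)) * G"
        unfolding G_def of_real_mult of_real_minus c_def of_real_diff of_real_1 ..
      show ?thesis
        unfolding h_def w_def G c G_def[symmetric] by (simp add: algebra_simps)
    qed
    ultimately have "((\<lambda>t. F \<xi> t - 1 + of_real (exp (- c * t) * \<xi>\<^sup>2 / 2)) has_vector_derivative h \<xi> t - w \<xi> t)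
        (at t within {0..})"
      by (simp only:)
    then show "(w \<xi> has_vector_derivative h \<xi> t - w \<xi> t) (at t within {0..})"
      by (simp only: w_def[abs_def])
    have two: "cmod (1 - F \<xi> t) \<le> 2" for \<xi>
      using norm_triangle_ineq4[of 1 "F \<xi> t"] cmod_F_le_one[OF t, of \<xi>] by simp
    have contract: "(s t * (r * \<xi>))\<^sup>2 \<le> (s t * \<xi>)\<^sup>2" if "0 < r" "r < 1" for r
      using that by (auto simp: power_mult_distrib mult.left_commute[of _ "r\<^sup>2"] intro!: mult_left_le_one_le power_le_one)
    \<comment> \<open>in the product \<open>(1 - F (p * \<xi>) t) * (1 - F (q * \<xi>) t)\<close>, one factor gives \<open>x\<^sup>2\<close>, the other, by interpolation between \<open>2\<close> and \<open>x\<^sup>2\<close>, gives \<open>x powr \<delta>\<close>\<close>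
    show "cmod (h \<xi> t) \<le> cmod (w (p * \<xi>) t) + cmod (w (q * \<xi>) t) + \<bar>s t * \<xi>\<bar> powr a"
    proof -
      define x where "x = \<bar>s t * \<xi>\<bar>"
      have P: "cmod (1 - F (p * \<xi>) t) \<le> x\<^sup>2 / 2"
        using cmod_one_minus_F[OF t, of "p * \<xi>"] contract[OF p_pos p_less_one] by (simp add: x_def)
      have Q: "cmod (1 - F (q * \<xi>) t) \<le> x\<^sup>2 / 2"
        using cmod_one_minus_F[OF t, of "q * \<xi>"] contract[OF q_pos q_less_one] by (simp add: x_def)
      have Q': "cmod (1 - F (q * \<xi>) t) \<le> 2 * x powr \<delta>"
      proof (cases "x \<le> 1")
        case True
        show ?thesis
        proof (cases "x = 0")
          case False
          have "x\<^sup>2 = x powr 2" using False by (simp add: x_def)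
          also have "\<dots> \<le> x powr \<delta>" using True \<delta> by (intro powr_mono') (auto simp: x_def)
          finally show ?thesis using Q powr_ge_zero[of x \<delta>] by linarith
        qed (use Q in simp)
      next
        case False
        then have "1 \<le> x powr \<delta>" using \<delta> by (simp add: ge_one_powr_ge_zero)
        then show ?thesis using two[of "q * \<xi>"] by linarith
      qed
      have "cmod ((1 - F (p * \<xi>) t) * (1 - F (q * \<xi>) t)) \<le> x\<^sup>2 / 2 * (2 * x powr \<delta>)"
        unfolding norm_mult using P Q' by (intro mult_mono) auto
      also have "\<dots> = x powr a" by (cases "x = 0") (simp_all add: a_def powr_add x_def)
      finally show ?thesis
        unfolding h_def x_def[symmetric] by (intro norm_triangle_mono norm_triangle_ineq)
    qed
    have scal: "\<bar>r * \<xi>\<bar> powr a = r powr a * \<bar>\<xi>\<bar> powr a" if "0 < r" for r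
      using that by (simp add: abs_mult powr_mult)
    define e where "e = exp (- (c / 2 * a) * t)"
    have "0 \<le> (C * S - 1) * (e * \<bar>\<xi>\<bar> powr a)"
      using CS by (intro mult_nonneg_nonneg) (auto simp: e_def)
    then show "C * exp (- (c / 2 * a) * t) * \<bar>p * \<xi>\<bar> powr a + C * exp (- (c / 2 * a) * t) * \<bar>q * \<xi>\<bar> powr a
        + \<bar>s t * \<xi>\<bar> powr a \<le> C * exp (- (c / 2 * a) * t) * \<bar>\<xi>\<bar> powr a
        + - (c / 2 * a) * (C * exp (- (c / 2 * a) * t) * \<bar>\<xi>\<bar> powr a)"
      unfolding S_eq scal[OF p_pos] scal[OF q_pos] powr_eq e_def[symmetric] by (simp add: algebra_simps)
    have "cmod (w \<xi> t) \<le> cmod (1 - F \<xi> t) + cmod (of_real ((s t * \<xi>)\<^sup>2 / 2))"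
      unfolding w_def sq_eq using norm_triangle_ineq[of "F \<xi> t - 1" "of_real (exp (- c * t) * \<xi>\<^sup>2 / 2)"]
      by (simp only: norm_minus_commute)
    also have "cmod (of_real ((s t * \<xi>)\<^sup>2 / 2)) \<le> \<xi>\<^sup>2"
    proof -
      have "(s t)\<^sup>2 * \<xi>\<^sup>2 \<le> \<xi>\<^sup>2"
        using s_le_one[OF t] s_pos[of t] by (intro mult_left_le_one_le) (auto simp: power_le_one)
      moreover have "0 \<le> (s t)\<^sup>2 * \<xi>\<^sup>2" by simp
      ultimately show ?thesis unfolding norm_of_real power_mult_distrib by linarith
    qed
    finally show "cmod (w \<xi> t) \<le> 2 + \<xi>\<^sup>2" using two[of \<xi>] by linarith
  qed (use that \<open>0 \<le> C\<close> in auto)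
  then show ?thesis
    using \<open>0 \<le> C\<close> that[of C] by (simp add: w_def sq_eq powr_eq[unfolded a_def] a_def mult.assoc)
qed

text \<open>At \<open>\<xi> = 1 / N\<close> the remainder is of order \<open>N powr (- (2 + \<delta>))\<close>, so it disappears from the difference
quotient \<open>2 N\<^sup>2 (1 - Re F)\<close>.\<close>

lemma second_moment_f:
  assumes \<delta>: "0 < \<delta>"
    and rem: "\<And>\<xi>. cmod (F \<xi> t - 1 + of_real ((s t * \<xi>)\<^sup>2 / 2)) \<le> C * \<bar>s t * \<xi>\<bar> powr (2 + \<delta>)"
    and t: "0 \<le> t"
  shows "second_moment (f t) = (s t)\<^sup>2"
proof (rule second_moment_eqI[OF integrable_f[OF t] f_nonneg[OF t] f_mass[OF t]],
    rule LIM_zero_cancel, rule Lim_null_comparison)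
  let ?N = "\<lambda>n. real (Suc n)"
  show "\<forall>\<^sub>F n in sequentially. norm (2 * (?N n)\<^sup>2 * (1 - Re (fourier (f t) (1 / ?N n))) - (s t)\<^sup>2)
      \<le> 2 * C * s t powr (2 + \<delta>) * ?N n powr (- \<delta>)"
  proof (intro always_eventually allI)
    fix n
    define N where "N = ?N n"
    have N: "0 < N" by (simp add: N_def)
    define r where "r = F (1 / N) t - 1 + of_real ((s t * (1 / N))\<^sup>2 / 2)"
    have "2 * N\<^sup>2 * (1 - Re (F (1 / N) t)) - (s t)\<^sup>2 = - (2 * N\<^sup>2) * Re r"
      using N by (simp add: r_def field_simps power_mult_distrib power_divide)
    also have "norm \<dots> = 2 * N\<^sup>2 * \<bar>Re r\<bar>" by (simp add: abs_mult)
    also have "\<dots> \<le> 2 * N\<^sup>2 * (C * \<bar>s t * (1 / N)\<bar> powr (2 + \<delta>))"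
      using rem[of "1 / N"] abs_Re_le_cmod[of r] by (intro mult_left_mono) (auto simp: r_def)
    also have "\<bar>s t * (1 / N)\<bar> powr (2 + \<delta>) = s t powr (2 + \<delta>) * (N powr (- \<delta>) / N\<^sup>2)"
      using N s_pos[of t] by (simp add: powr_divide powr_add powr_minus divide_simps)
    finally show "norm (2 * (?N n)\<^sup>2 * (1 - Re (fourier (f t) (1 / ?N n))) - (s t)\<^sup>2)
        \<le> 2 * C * s t powr (2 + \<delta>) * ?N n powr (- \<delta>)"
      using N unfolding F_def N_def[symmetric] by (simp add: field_simps)
  qed
  have "filterlim ?N at_top sequentially"
    using filterlim_Suc filterlim_real_sequentially filterlim_compose by blast
  then have "(\<lambda>n. ?N n powr (- \<delta>)) \<longlonglongrightarrow> 0"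
    using \<delta> by (intro tendsto_neg_powr) auto
  then show "(\<lambda>n. 2 * C * s t powr (2 + \<delta>) * ?N n powr (- \<delta>)) \<longlonglongrightarrow> 0"
    by (rule tendsto_mult_right_zero)
qed

text \<open>Choose \<open>\<rho>\<close> so that the remainder takes at most half of the quadratic term \<open>x\<^sup>2 / 2\<close>.\<close>

lemma F_gaussian_near_zero:
  assumes \<delta>: "0 < \<delta>" and "0 \<le> C"
    and rem: "\<And>\<xi> t. 0 \<le> t \<Longrightarrow> cmod (F \<xi> t - 1 + of_real ((s t * \<xi>)\<^sup>2 / 2)) \<le> C * \<bar>s t * \<xi>\<bar> powr (2 + \<delta>)"
  obtains \<rho> where "0 < \<rho>"
    "\<And>\<xi> t. 0 \<le> t \<Longrightarrow> \<bar>s t * \<xi>\<bar> \<le> \<rho> \<Longrightarrow> cmod (F \<xi> t) \<le> exp (- (1/4) * (s t * \<xi>)\<^sup>2)"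
proof -
  define \<rho> where "\<rho> = min 1 ((1 / (4 * (C + 1))) powr (1 / \<delta>))"
  have \<rho>: "0 < \<rho>" "\<rho> \<le> 1" using \<open>0 \<le> C\<close> by (auto simp: \<rho>_def)
  have "\<rho> powr \<delta> \<le> ((1 / (4 * (C + 1))) powr (1 / \<delta>)) powr \<delta>"
    using \<rho> \<delta> by (intro powr_mono2) (auto simp: \<rho>_def)
  also have "\<dots> = 1 / (4 * (C + 1))" using \<delta> \<open>0 \<le> C\<close> by (simp add: powr_powr)
  finally have "C * \<rho> powr \<delta> \<le> C * (1 / (4 * (C + 1)))"
    using \<open>0 \<le> C\<close> by (intro mult_left_mono)
  also have "\<dots> \<le> 1 / 4" using \<open>0 \<le> C\<close> by (simp add: field_simps)
  finally have C\<rho>: "C * \<rho> powr \<delta> \<le> 1 / 4" .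
  have "cmod (F \<xi> t) \<le> exp (- (1/4) * (s t * \<xi>)\<^sup>2)" if t: "0 \<le> t" and small: "\<bar>s t * \<xi>\<bar> \<le> \<rho>" for \<xi> t
  proof -
    define x where "x = \<bar>s t * \<xi>\<bar>"
    have x: "0 \<le> x" "x \<le> \<rho>" "x \<le> 1" using small \<rho> by (auto simp: x_def)
    have sq: "(s t * \<xi>)\<^sup>2 = x\<^sup>2" by (simp add: x_def)
    have "C * x powr (2 + \<delta>) = C * x powr \<delta> * x\<^sup>2"
      using x by (cases "x = 0") (simp_all add: powr_add)
    also have "\<dots> \<le> 1 / 4 * x\<^sup>2"
    proof (intro mult_right_mono)
      have "C * x powr \<delta> \<le> C * \<rho> powr \<delta>"
        using x \<delta> \<open>0 \<le> C\<close> by (intro mult_left_mono powr_mono2) auto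
      then show "C * x powr \<delta> \<le> 1 / 4" using C\<rho> by linarith
    qed simp
    finally have "cmod (F \<xi> t - 1 + of_real (x\<^sup>2 / 2)) \<le> 1 / 4 * x\<^sup>2"
      using rem[OF t, of \<xi>] unfolding sq x_def[symmetric] by linarith
    moreover have "x\<^sup>2 \<le> 1" using x by (simp add: power_le_one)
    then have "cmod (of_real (1 - x\<^sup>2 / 2)) = 1 - x\<^sup>2 / 2"
      by (subst norm_of_real) auto
    moreover have "F \<xi> t = of_real (1 - x\<^sup>2 / 2) + (F \<xi> t - 1 + of_real (x\<^sup>2 / 2))" by simp
    then have "cmod (F \<xi> t) \<le> cmod (of_real (1 - x\<^sup>2 / 2)) + cmod (F \<xi> t - 1 + of_real (x\<^sup>2 / 2))"
      by (metis norm_triangle_ineq)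
    ultimately have "cmod (F \<xi> t) \<le> 1 + - (1/4) * x\<^sup>2" by linarith
    also have "\<dots> \<le> exp (- (1/4) * x\<^sup>2)" by (rule exp_ge_add_one_self)
    finally show ?thesis unfolding sq .
  qed
  then show ?thesis using that \<rho> by blast
qed

text \<open>A point in the outer region at time \<open>t\<close> was there at all earlier times, since \<open>s\<close> decreases. So on \<open>[0, t]\<close> the
product \<open>F(p\<xi>) F(q\<xi>)\<close> stays below \<open>exp (-\<kappa> x powr m)\<close>, where \<open>x\<close> is taken at the final time, and \<open>F\<close> relaxes
towards it from an initial value below it. The values at \<open>p\<xi>\<close> and \<open>q\<xi>\<close> are provided by induction on an
\<open>n\<close> with \<open>|\<xi>| p^n \<le> \<rho>\<close>; for \<open>n = 0\<close> the outer region is empty.\<close>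

lemma F_tail_propagates:
  assumes pos: "0 < m" "0 < \<rho>" "0 \<le> \<kappa>\<^sub>1" "0 \<le> \<kappa>" and pq: "1 \<le> p powr m + q powr m"
    and inner: "\<And>\<xi> t. 0 \<le> t \<Longrightarrow> \<bar>s t * \<xi>\<bar> \<le> \<rho> \<Longrightarrow> cmod (F \<xi> t) \<le> exp (- \<kappa>\<^sub>1 * (s t * \<xi>)\<^sup>2)"
    and init: "\<And>\<xi>. \<bar>\<xi>\<bar> > \<rho> \<Longrightarrow> cmod (F \<xi> 0) \<le> exp (- \<kappa> * \<bar>\<xi>\<bar> powr m)"
    and small: "\<kappa> * (\<rho> / q) powr m \<le> \<kappa>\<^sub>1 * (q * \<rho>)\<^sup>2"
    and t: "0 \<le> t" and outer: "\<bar>s t * \<xi>\<bar> > \<rho>"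
  shows "cmod (F \<xi> t) \<le> exp (- \<kappa> * \<bar>s t * \<xi>\<bar> powr m)"
proof -
  have "cmod (F \<xi> t) \<le> exp (- \<kappa> * \<bar>s t * \<xi>\<bar> powr m)"
    if "\<bar>\<xi>\<bar> * p ^ n \<le> \<rho>" "0 \<le> t" "\<bar>s t * \<xi>\<bar> > \<rho>" for n \<xi> t
    using that
  proof (induction n arbitrary: \<xi> t)
    case 0
    have "\<bar>s t * \<xi>\<bar> \<le> \<bar>\<xi>\<bar>"
      using s_le_one[OF 0(2)] s_pos[of t] by (simp add: abs_mult mult_left_le_one_le)
    with 0 show ?case by simp
  next
    case (Suc n)
    show ?case
    proof (rule relaxation_bound[where h = "\<lambda>u. F (p * \<xi>) u * F (q * \<xi>) u" and B' = "\<lambda>_. 0"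
          and B = "\<lambda>_. exp (- \<kappa> * \<bar>s t * \<xi>\<bar> powr m)", OF Suc.prems(2)])
      have shrink: "\<bar>s t * \<xi>\<bar> \<le> \<bar>s u * \<xi>\<bar>" if "u \<le> t" for u
        using s_antimono[OF that] s_pos[of t] s_pos[of u] by (simp add: abs_mult mult_right_mono)
      have decay: "exp (- \<kappa> * \<bar>s u * \<xi>\<bar> powr m) \<le> exp (- \<kappa> * \<bar>s t * \<xi>\<bar> powr m)" if "u \<le> t" for u
        using shrink[OF that] pos by (auto intro!: mult_left_mono powr_mono2)
      have "\<bar>\<xi>\<bar> > \<rho>" using shrink[OF Suc.prems(2)] Suc.prems(3) by (simp add: s_zero)
      then show "cmod (F \<xi> 0) \<le> exp (- \<kappa> * \<bar>s t * \<xi>\<bar> powr m)"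
        using order_trans[OF init decay[OF Suc.prems(2), unfolded s_zero mult_1]] by simp
      fix u assume u: "0 \<le> u" "u \<le> t"
      define x where "x = \<bar>s u * \<xi>\<bar>"
      have "x > \<rho>" using shrink[OF u(2)] Suc.prems(3) by (simp add: x_def)
      have scaled: "\<bar>s u * (r * \<xi>)\<bar> = r * x" if "0 < r" for r
        using that by (simp add: x_def abs_mult)
      have IH: "cmod (F (r * \<xi>) u) \<le> exp (- \<kappa> * (r * x) powr m)" if "0 < r" "r \<le> p" "r * x > \<rho>" for r
      proof -
        have "\<bar>r * \<xi>\<bar> * p ^ n \<le> (p * \<bar>\<xi>\<bar>) * p ^ n"
          using that p_pos by (intro mult_right_mono) (auto simp: abs_mult mult_right_mono)
        also have "\<dots> \<le> \<rho>" using Suc.prems(1) by (simp add: mult_ac)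
        finally show ?thesis using Suc.IH[OF _ u(1), of "r * \<xi>"] that(1,3) by (simp add: scaled)
      qed
      have "cmod (F (p * \<xi>) u * F (q * \<xi>) u) \<le> exp (- \<kappa> * x powr m)"
      \<comment> \<open>if both factors lie in the outer region, the condition on \<open>m\<close> is what is needed; otherwise \<open>q * x \<le> \<rho>\<close> keeps \<open>x\<close> in a bounded interval, on which \<open>\<kappa>\<close> is small enough\<close>
      proof (cases "q * x > \<rho>")
        case True
        then have "p * x > \<rho>"
          using q_le_p \<open>x > \<rho>\<close> pos mult_right_mono[of q p x] by linarith
        have "cmod (F (p * \<xi>) u * F (q * \<xi>) u) \<le> exp (- \<kappa> * (p * x) powr m) * exp (- \<kappa> * (q * x) powr m)"
          unfolding norm_mult using True \<open>p * x > \<rho>\<close> q_le_p p_pos q_pos by (intro mult_mono IH) auto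
        also have "\<dots> = exp (- \<kappa> * ((p powr m + q powr m) * x powr m))"
          using p_pos q_pos \<open>x > \<rho>\<close> pos by (simp add: exp_add[symmetric] powr_mult algebra_simps)
        also have "\<dots> \<le> exp (- \<kappa> * x powr m)"
          using pq pos mult_right_mono[OF pq, of "x powr m"] by (simp add: mult_left_mono)
        finally show ?thesis .
      next
        case False
        have "cmod (F (p * \<xi>) u * F (q * \<xi>) u) \<le> 1 * exp (- \<kappa>\<^sub>1 * (s u * (q * \<xi>))\<^sup>2)"
          unfolding norm_mult using inner[OF u(1), of "q * \<xi>"] False q_pos cmod_F_le_one[OF u(1)]
          by (intro mult_mono) (auto simp: scaled)
        also have "\<dots> = exp (- \<kappa>\<^sub>1 * (q * x)\<^sup>2)"
          using scaled[OF q_pos] by (metis mult_1 power2_abs)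
        also have "\<dots> \<le> exp (- \<kappa>\<^sub>1 * (q * \<rho>)\<^sup>2)"
          using \<open>x > \<rho>\<close> pos q_pos by (auto intro!: mult_left_mono power_mono)
        also have "\<dots> \<le> exp (- \<kappa> * (\<rho> / q) powr m)" using small by simp
        also have "\<dots> \<le> exp (- \<kappa> * x powr m)"
          using False q_pos pos \<open>x > \<rho>\<close> by (auto intro!: mult_left_mono powr_mono2 simp: field_simps)
        finally show ?thesis .
      qed
      then show "cmod (F (p * \<xi>) u * F (q * \<xi>) u) \<le> exp (- \<kappa> * \<bar>s t * \<xi>\<bar> powr m) + 0"
        using order_trans[OF _ decay[OF u(2)]] by (simp add: x_def)
    qed (use F_derivative in auto)
  qed
  moreover obtain n where "\<bar>\<xi>\<bar> * p ^ n \<le> \<rho>"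
  proof -
    have "(\<lambda>n. \<bar>\<xi>\<bar> * p ^ n) \<longlonglongrightarrow> \<bar>\<xi>\<bar> * 0"
      using p_pos p_less_one by (intro tendsto_intros LIMSEQ_power_zero) auto
    then have "\<forall>\<^sub>F n in sequentially. \<bar>\<xi>\<bar> * p ^ n < \<rho>"
      using pos by (intro order_tendstoD(2)[of _ "\<bar>\<xi>\<bar> * 0"]) auto
    then show ?thesis using that by (auto simp: eventually_sequentially intro: less_imp_le)
  qed
  ultimately show ?thesis using t outer by blast
qed

end

section \<open>Uniform decay of the scaled solution\<close>

theorem theorem3:
  fixes p q \<delta>t lam R \<nu> \<beta> :: real
    and g0 :: "real \<Rightarrow> real"
    and g :: "real \<Rightarrow> real \<Rightarrow> real"
  assumes "0 < q" and "q \<le> p" and "p\<^sup>2 + q\<^sup>2 < 1"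
    and "0 < \<delta>t" and "\<delta>t < 1"
    and "\<And>\<delta>. 0 < \<delta> \<Longrightarrow> \<delta> < \<delta>t \<Longrightarrow> S_fun p q \<delta> < 0"
    and "0 < lam" and "lam < 2" and "p powr lam + q powr lam = 1"
    and "\<And>v. g0 v \<ge> 0"
    and "has_bochner_integral lebesgue g0 1"
    and "has_bochner_integral lebesgue (\<lambda>v. v * g0 v) 0"
    and "has_bochner_integral lebesgue (\<lambda>v. v\<^sup>2 * g0 v) 1"
    and "integrable lebesgue (\<lambda>v. \<bar>v\<bar> powr (2 + \<delta>t) * g0 v)"
    and "scaled_weak_solution p q g0 g"
    and "0 < R" and "0 < \<nu>" and "0 < \<beta>"
    and "\<And>\<xi>. \<bar>\<xi>\<bar> > R \<Longrightarrow> cmod (fourier g0 \<xi>) \<le> exp (- \<beta> * \<bar>\<xi>\<bar> powr \<nu>)"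
  shows "\<exists>\<rho>>0. \<exists>\<kappa>>0. \<forall>t\<ge>0. \<forall>\<xi>.
           (\<bar>\<xi>\<bar> \<le> \<rho> \<longrightarrow> cmod (fourier (g t) \<xi>) \<le> exp (- \<kappa> * \<xi>\<^sup>2)) \<and>
           (\<bar>\<xi>\<bar> > \<rho> \<longrightarrow> cmod (fourier (g t) \<xi>) \<le> exp (- \<kappa> * \<bar>\<xi>\<bar> powr (min \<nu> lam)))"
proof -
  obtain f where f: "weak_solution p q g0 f"
    and g: "\<And>t v. 0 \<le> t \<Longrightarrow> g t v = sqrt (second_moment (f t)) * f t (v * sqrt (second_moment (f t)))"
    using assms(15) by (auto simp: scaled_weak_solution_def)
  interpret dissipative_flow p q g0 f
    using assms f by unfold_locales auto
  \<comment> \<open>the sign of \<open>S_fun\<close> is known on the open interval only, so an exponent strictly below \<open>\<delta>t\<close> is taken\<close>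
  define \<delta> where "\<delta> = \<delta>t / 2"
  have \<delta>: "0 < \<delta>" "\<delta> \<le> 1" "\<delta> < \<delta>t" using assms(4,5) by (auto simp: \<delta>_def)
  have moment: "integrable lebesgue (\<lambda>v. \<bar>v\<bar> powr (2 + \<delta>) * g0 v)"
    by (rule integrable_lower_moment[OF g_nonneg integrable.intros[OF g_mass] integrable.intros[OF g_energy] assms(14)])
       (use \<delta> in auto)
  obtain C where C: "0 \<le> C"
    and rem: "\<And>\<xi> t. 0 \<le> t \<Longrightarrow> cmod (F \<xi> t - 1 + of_real ((s t * \<xi>)\<^sup>2 / 2)) \<le> C * \<bar>s t * \<xi>\<bar> powr (2 + \<delta>)"
    by (rule F_remainder_bound[OF \<delta>(1,2) assms(6)[OF \<delta>(1,3)] moment]) (rule that)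
  have fourier_g: "fourier (g t) \<xi> = F (\<xi> / s t) t" if "0 \<le> t" for t \<xi>
  proof -
    have "sqrt (second_moment (f t)) = s t"
      using second_moment_f[OF \<delta>(1) rem[OF that] that] s_pos[of t] by simp
    then have "g t = (\<lambda>v. s t * f t (v * s t))" using g[OF that] by auto
    then show ?thesis
      using fourier_rescale[OF borel_measurable_integrable[OF integrable_f[OF that]] s_pos]
      by (simp add: F_def)
  qed
  obtain \<rho> where \<rho>: "0 < \<rho>" and inner:
    "\<And>\<xi> t. 0 \<le> t \<Longrightarrow> \<bar>s t * \<xi>\<bar> \<le> \<rho> \<Longrightarrow> cmod (F \<xi> t) \<le> exp (- (1/4) * (s t * \<xi>)\<^sup>2)"
    by (rule F_gaussian_near_zero[OF \<delta>(1) C]) (erule rem, rule that)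
  define m where "m = min \<nu> lam"
  have m: "0 < m" "m \<le> \<nu>" "m \<le> lam" using assms(7,17) by (auto simp: m_def)
  have "p powr lam \<le> p powr m" "q powr lam \<le> q powr m"
    using m p_pos q_pos p_less_one q_less_one by (auto intro!: powr_mono')
  then have pq: "1 \<le> p powr m + q powr m" using assms(9) by linarith
  have density: "integrable lebesgue g0" "AE v in lebesgue. 0 \<le> g0 v" "(LINT v|lebesgue. g0 v) = 1"
    using g_mass by (simp_all add: has_bochner_integral_iff g_nonneg)
  obtain \<kappa>\<^sub>0 where "0 < \<kappa>\<^sub>0" and
    init: "\<And>\<xi>. \<bar>\<xi>\<bar> > \<rho> \<Longrightarrow> cmod (fourier g0 \<xi>) \<le> exp (- \<kappa>\<^sub>0 * \<bar>\<xi>\<bar> powr m)"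
    by (rule fourier_uniform_tail[OF density assms(16,18) m(1) \<rho> m(2) assms(19)]) (assumption, rule that)
  \<comment> \<open>small enough for the Gaussian bound, for the initial tail, and for the Gaussian bound at \<open>q * \<rho>\<close> to beat the tail bound at \<open>\<rho> / q\<close>\<close>
  define \<kappa> where "\<kappa> = min (1/4) (min \<kappa>\<^sub>0 (1/4 * (q * \<rho>)\<^sup>2 / (\<rho> / q) powr m))"
  have "0 < \<kappa>" "\<kappa> \<le> 1/4" "\<kappa> \<le> \<kappa>\<^sub>0" using \<open>0 < \<kappa>\<^sub>0\<close> \<rho> q_pos by (auto simp: \<kappa>_def)
  have small: "\<kappa> * (\<rho> / q) powr m \<le> 1/4 * (q * \<rho>)\<^sup>2"
  proof -
    have "\<kappa> \<le> 1/4 * (q * \<rho>)\<^sup>2 / (\<rho> / q) powr m"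
      unfolding \<kappa>_def by (intro min.coboundedI2 order_refl)
    moreover have "0 < (\<rho> / q) powr m" using \<rho> q_pos by simp
    ultimately show ?thesis by (simp only: pos_le_divide_eq)
  qed
  have init': "cmod (F \<xi> 0) \<le> exp (- \<kappa> * \<bar>\<xi>\<bar> powr m)" if "\<bar>\<xi>\<bar> > \<rho>" for \<xi>
  proof -
    have "cmod (F \<xi> 0) \<le> exp (- \<kappa>\<^sub>0 * \<bar>\<xi>\<bar> powr m)"
      unfolding F_initial by (rule init[OF that])
    also have "\<dots> \<le> exp (- \<kappa> * \<bar>\<xi>\<bar> powr m)"
      using \<open>\<kappa> \<le> \<kappa>\<^sub>0\<close> by (simp add: mult_right_mono)
    finally show ?thesis .
  qed
  have "cmod (fourier (g t) \<xi>) \<le> exp (- \<kappa> * \<xi>\<^sup>2)" if "0 \<le> t" "\<bar>\<xi>\<bar> \<le> \<rho>" for t \<xi>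
  proof -
    have "cmod (fourier (g t) \<xi>) \<le> exp (- (1/4) * \<xi>\<^sup>2)"
      using inner[OF that(1), of "\<xi> / s t"] that s_pos[of t] by (simp add: fourier_g)
    also have "\<dots> \<le> exp (- \<kappa> * \<xi>\<^sup>2)"
      using mult_right_mono[OF \<open>\<kappa> \<le> 1/4\<close> zero_le_power2[of \<xi>]] by simp
    finally show ?thesis .
  qed
  moreover have "cmod (fourier (g t) \<xi>) \<le> exp (- \<kappa> * \<bar>\<xi>\<bar> powr m)" if "0 \<le> t" "\<bar>\<xi>\<bar> > \<rho>" for t \<xi>
    using F_tail_propagates[OF m(1) \<rho> _ _ pq inner init' small that(1), of "\<xi> / s t"]
      that s_pos[of t] \<open>0 < \<kappa>\<close> by (simp add: fourier_g)
  ultimately show ?thesis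
    using \<rho> \<open>0 < \<kappa>\<close> unfolding m_def by blast
qed

end
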